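(* Let $0<C<1$ and $C_1,C_2\in(0,2]$. Consider the adaptive dynamics of the alternating memory-1 game with payoff vector $(f_1,f_2,f_3,f_4)=(1-C,-C,1,0)$, restricted to the torus $(p_1-1)^2+p_3^2=C_1$, $(p_2-1)^2+p_4^2=C_2$, which is parametrised by angles $\phi,\psi$ via $$p_1=1+\sqrt{C_1}\sin\phi,\quad p_2=1+\sqrt{C_2}\sin\psi,\quad p_3=\sqrt{C_1}\cos\phi,\quad p_4=\sqrt{C_2}\cos\psi.$$ For $s\in(0,2]$ let $I(s)=\left(\tfrac{3\pi}2,2\pi\right)$ if $0<s\le1$ and $I(s)=\left(2\pi-\arcsin\tfrac1{\sqrt s},\,2\pi-\arccos\tfrac1{\sqrt s}\right)$ if $1<s\le2$, so that $I(C_1)\times I(C_2)$ is the set of $(\phi,\psi)\in[0,2\pi]^2$ corresponding to points of $(0,1)^4$. Put $$K=\frac{C_2+2C_2C^2-C_1}{2C\sqrt{1+C^2}\,C_2}.$$ Equilibria of the dynamics exist in $I(C_1)\times I(C_2)$ (the image of $(0,1)^4$) if there exist $k,l\in\mathbb Z$ such that, with $$\psi=\tfrac12\left(\arcsin K+\arccos\tfrac{C}{\sqrt{1+C^2}}\right)+\pi k\quad\text{or}\quad\psi=\tfrac12\left(-\arcsin K+\arccos\tfrac{C}{\sqrt{1+C^2}}\right)+\tfrac{2k+1}2\pi,$$ and $$\phi=\tfrac\pi4+\arcsin\left(\sqrt{\tfrac{C_2}{C_1}}\sin\left(\psi-\tfrac\pi4\right)\right)+2\pi l\quad\text{or}\quad\phi=\tfrac\pi4-\arcsin\left(\sqrt{\tfrac{C_2}{C_1}}\sin\left(\psi-\tfrac\pi4\right)\right)+\pi(2l+1)$$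 (all arguments of $\arcsin$ being required to lie in $[-1,1]$), one has $\phi\in I(C_1)$ and $\psi\in I(C_2)$.
   Context: Write $\mathbf p=(p_1,p_2,p_3,p_4)=(p_{CC},p_{CD},p_{DC},p_{DD})$ and similarly $\mathbf q$. The transition matrix of the alternating memory-1 game is $$\mathbf M_1(\mathbf p,\mathbf q)=\begin{pmatrix} p_1q_1&p_1(1-q_1)&(1-p_1)q_2&(1-p_1)(1-q_2)\\ p_2q_3&p_2(1-q_3)&(1-p_2)q_4&(1-p_2)(1-q_4)\\ p_3q_1&p_3(1-q_1)&(1-p_3)q_2&(1-p_3)(1-q_2)\\ p_4q_3&p_4(1-q_3)&(1-p_4)q_4&(1-p_4)(1-q_4)\end{pmatrix}.$$ The payoff function is $A(\mathbf p,\mathbf q)=\det\mathbf M^1/\det\mathbf M^2$, where $\mathbf M^1$ is $\mathbf M_1(\mathbf p,\mathbf q)-I$ with its last column replaced by $(f_1,f_2,f_3,f_4)^T$ and $\mathbf M^2$ is $\mathbf M_1(\mathbf p,\mathbf q)-I$ with its last column replaced by $(1,1,1,1)^T$. The adaptive dynamics is the system $\dot p_i=\left.\frac{\partial A(\mathbf p,\mathbf q)}{\partial p_i}\right|_{\mathbf q=\mathbf p}$, $i=1,\ldots,4$. It is defined on $(0,1)^4$, and the functions $(p_1-1)^2+p_3^2$ and $(p_2-1)^2+p_4^2$ are constant along its solutions, so it restricts to their common level sets. An equilibrium is a point where all $\dot p_i$ vanish. $\arcsin$ takes values in $[-\pi/2,\pi/2]$ and $\arccos$ in $[0,\pi]$.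 *)

theory Defs
  imports "HOL-Analysis.Analysis"
begin

lemma vector_4:
  "(vector [w, x, y, z] :: ('a::zero)^4) $ 1 = w"
  "(vector [w, x, y, z] :: ('a::zero)^4) $ 2 = x"
  "(vector [w, x, y, z] :: ('a::zero)^4) $ 3 = y"
  "(vector [w, x, y, z] :: ('a::zero)^4) $ 4 = z"
  unfolding vector_def by simp_all

text \<open>Indices 1, 2, 3, 4 stand for the outcomes CC, CD, DC, DD.\<close>

definition transition_matrix :: "real^4 \<Rightarrow> real^4 \<Rightarrow> real^4^4" where
  "transition_matrix p q = vector
    [vector [p$1 * q$1, p$1 * (1 - q$1), (1 - p$1) * q$2, (1 - p$1) * (1 - q$2)],
     vector [p$2 * q$3, p$2 * (1 - q$3), (1 - p$2) * q$4, (1 - p$2) * (1 - q$4)],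
     vector [p$3 * q$1, p$3 * (1 - q$1), (1 - p$3) * q$2, (1 - p$3) * (1 - q$2)],
     vector [p$4 * q$3, p$4 * (1 - q$3), (1 - p$4) * q$4, (1 - p$4) * (1 - q$4)]]"

definition replace_last_column :: "real^4^4 \<Rightarrow> real^4 \<Rightarrow> real^4^4" where
  "replace_last_column M v = (\<chi> i j. if j = 4 then v$i else M$i$j)"

definition payoff :: "real^4 \<Rightarrow> real^4 \<Rightarrow> real^4 \<Rightarrow> real" where
  "payoff f p q =
     det (replace_last_column (transition_matrix p q - mat 1) f) /
     det (replace_last_column (transition_matrix p q - mat 1) (vector [1, 1, 1, 1]))"

text \<open>
  The derivative is taken in the first strategy only: the second argument of
  \<open>payoff\<close> stays at \<open>p\<close> while the \<open>i\<close>-th coordinate of the first one varies.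
\<close>

definition adaptive_field :: "real^4 \<Rightarrow> real^4 \<Rightarrow> real^4" where
  "adaptive_field f p =
     (\<chi> i. deriv (\<lambda>t. payoff f (\<chi> j. if j = i then t else p$j) p) (p$i))"

definition is_equilibrium :: "real^4 \<Rightarrow> real^4 \<Rightarrow> bool" where
  "is_equilibrium f p \<longleftrightarrow>
     (\<forall>i. 0 < p$i \<and> p$i < 1) \<and> (\<forall>i. adaptive_field f p $ i = 0)"

definition torus_point :: "real \<Rightarrow> real \<Rightarrow> real \<Rightarrow> real \<Rightarrow> real^4" where
  "torus_point C1 C2 \<phi> \<psi> = vector
    [1 + sqrt C1 * sin \<phi>, 1 + sqrt C2 * sin \<psi>, sqrt C1 * cos \<phi>, sqrt C2 * cos \<psi>]"

text \<open>
  For \<open>0 < s \<le> 2\<close>, the angles \<open>\<theta>\<close> in \<open>[0, 2 * pi]\<close> for which both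
  \<open>1 + sqrt s * sin \<theta>\<close> and \<open>sqrt s * cos \<theta>\<close> lie strictly between 0 and 1
  (none for \<open>s = 2\<close>).
\<close>

definition angle_interval :: "real \<Rightarrow> real set" where
  "angle_interval s =
     (if s \<le> 1 then {3 * pi / 2 <..< 2 * pi}
      else {2 * pi - arcsin (1 / sqrt s) <..< 2 * pi - arccos (1 / sqrt s)})"

end

theory Submission
  imports Defs
begin

text \<open>
  If \<open>q\<close> is additive, i.e. \<open>q\<^sub>1 + q\<^sub>4 = q\<^sub>2 + q\<^sub>3\<close>, the second player cooperates with
  probability \<open>q\<^sub>4 + s y + r x\<close>, where \<open>y\<close> is his own last move, \<open>x\<close> the opponent's move,
  \<open>r = q\<^sub>1 - q\<^sub>2\<close> and \<open>s = q\<^sub>1 - q\<^sub>3\<close>. In the stationary distribution this gives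
  \<open>(1 - s) E y = q\<^sub>4 + r E x\<close>, so for \<open>r = C (1 - s)\<close> the first player's payoff
  \<open>E y - C E x\<close> equals \<open>q\<^sub>4 / (1 - s)\<close> whatever he does; hence every such point is an
  equilibrium.

  On the torus, the formula for \<open>\<phi>\<close> expresses additivity. Given additivity, the formula
  for \<open>\<psi>\<close> expresses \<open>(v + 2 C u)\<^sup>2 = w\<^sup>2\<close> with \<open>u = 1 - s\<close>,
  \<open>v = p\<^sub>2 - 1 + p\<^sub>4\<close> and \<open>w = p\<^sub>1 - 1 + p\<^sub>3\<close>, and \<open>v + 2 C u = w\<close> is the equation
  \<open>r = C (1 - s)\<close>. If the wrong sign occurs, the reflection \<open>\<phi> \<mapsto> 7 \<pi> / 2 - \<phi>\<close>, which
  preserves the interval and additivity, changes the sign of \<open>w\<close>.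
\<close>

text \<open>Maximum principle; it keeps the denominator of \<open>payoff\<close> away from 0. For
  \<open>x\<close> in the kernel, setting its last entry to 0 gives a \<open>y\<close> such that M y
  - y is constant. This constant is at most 0 at a maximum of \<open>y\<close> and at least 0 at a
  minimum, hence 0. Positivity of the row at the maximum then makes all entries of \<open>y\<close>
  equal to the last one.\<close>

lemma stochastic_4_replace_last_column_det_nz:
  fixes M :: "real^4^4"
  assumes pos: "\<And>i j. 0 < M$i$j" and stoch: "\<And>i. (\<Sum>j\<in>UNIV. M$i$j) = 1"
  shows "det (replace_last_column (M - mat 1) (vector [1, 1, 1, 1])) \<noteq> 0"
proof -
  let ?B = "replace_last_column (M - mat 1) (vector [1, 1, 1, 1])"
  have "x = 0" if x: "?B *v x = 0" for x
  proof -
    define y :: "real^4" where "y = (\<chi> j. if j = 4 then 0 else x$j)"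
    have one: "(vector [1, 1, 1, 1] :: real^4) $ i = 1" for i
      using exhaust_4[of i] by (auto simp: vector_4)
    have eq: "(\<Sum>j\<in>UNIV. M$i$j * (y$j - y$i)) = - x$4" for i
    proof -
      have "0 = (\<Sum>j\<in>UNIV. ?B$i$j * x$j)"
        using x by (simp add: vec_eq_iff matrix_vector_mult_def)
      also have "\<dots> = (\<Sum>j\<in>UNIV. M$i$j * y$j - (if i = j then y$j else 0) + (if j = 4 then x$4 else 0))"
        by (rule sum.cong) (auto simp: replace_last_column_def one y_def mat_def algebra_simps)
      also have "\<dots> = (\<Sum>j\<in>UNIV. M$i$j * y$j) - y$i + x$4"
        by (simp add: sum.distrib sum_subtractf)
      also have "y$i = (\<Sum>j\<in>UNIV. M$i$j * y$i)"
        by (simp add: stoch flip: sum_distrib_right)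
      finally show ?thesis by (simp add: right_diff_distrib sum_subtractf)
    qed
    have "Max (range (($) y)) \<in> range (($) y)" "Min (range (($) y)) \<in> range (($) y)"
      by (intro Max_in Min_in; simp)+
    then obtain m n where mn: "Max (range (($) y)) = y$m" "Min (range (($) y)) = y$n" by blast
    have m: "y$j \<le> y$m" and n: "y$n \<le> y$j" for j
      using Max_ge[of "range (($) y)" "y$j"] Min_le[of "range (($) y)" "y$j"] by (simp_all add: mn)
    have le: "M$m$j * (y$j - y$m) \<le> 0" for j
      using pos[of m j] m[of j] by (simp add: mult_le_0_iff)
    have "(\<Sum>j\<in>UNIV. M$m$j * (y$j - y$m)) \<le> 0"
      by (intro sum_nonpos) (use le in auto)
    moreover have "(\<Sum>j\<in>UNIV. M$n$j * (y$j - y$n)) \<ge> 0"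
      using less_imp_le[OF pos] n by (intro sum_nonneg) auto
    ultimately have x4: "x$4 = 0" using eq[of m] eq[of n] by simp
    have "(\<Sum>j\<in>UNIV. - (M$m$j * (y$j - y$m))) = 0"
      using eq[of m] x4 by (simp add: sum_negf)
    then have "M$m$j * (y$j - y$m) = 0" for j
      using le by (subst (asm) sum_nonneg_eq_0_iff) auto
    then have const: "y$j = y$m" for j
      using pos[of m j] by (metis less_irrefl mult_eq_0_iff right_minus_eq)
    have "y$j = 0" for j
      using const[of j] const[of 4] by (simp add: y_def)
    then show "x = 0"
      using x4 by (auto simp: vec_eq_iff y_def split: if_splits) metis
  qed
  then have "\<exists>D. D ** ?B = mat 1"
    by (simp add: matrix_left_invertible_ker)
  then have "invertible ?B"
    by (simp add: invertible_left_inverse)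
  then show ?thesis by (simp add: invertible_det_nz)
qed

lemma det_transition_matrix_nz:
  assumes p: "\<And>i. 0 < p$i \<and> p$i < 1" and q: "\<And>i. 0 < q$i \<and> q$i < 1"
  shows "det (replace_last_column (transition_matrix p q - mat 1) (vector [1, 1, 1, 1])) \<noteq> 0"
proof (rule stochastic_4_replace_last_column_det_nz)
  show "0 < transition_matrix p q $ i $ j" for i j
    using exhaust_4[of i] exhaust_4[of j] p q
    by (auto simp: transition_matrix_def vector_4)
  show "(\<Sum>j\<in>UNIV. transition_matrix p q $ i $ j) = 1" for i
    using exhaust_4[of i]
    by (auto simp: transition_matrix_def vector_4 sum_4 algebra_simps)
qed

text \<open>By Cramer's rule the payoff is the last coordinate of the solution of the linear system
  with matrix \<open>?B\<close> and right-hand side \<open>?f\<close>. That solution is given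
  explicitly, so no determinant is expanded.\<close>

lemma payoff_equalizer:
  assumes p: "\<And>i. 0 < p$i \<and> p$i < 1" and q: "\<And>i. 0 < q$i \<and> q$i < 1"
    and additive: "q$1 + q$4 = q$2 + q$3"
    and slope: "q$1 - q$2 = C * (1 - q$2 + q$4)"
  shows "payoff (vector [1 - C, - C, 1, 0]) p q = q$4 / (1 - q$2 + q$4)"
proof -
  define u where "u = 1 - q$2 + q$4"
  let ?f = "vector [1 - C, - C, 1, 0] :: real^4"
  let ?N = "transition_matrix p q - mat 1"
  let ?B = "replace_last_column ?N (vector [1, 1, 1, 1])"
  \<comment> \<open>up to the factor \<open>-1/u\<close>, the first three entries are those of \<open>y - r x\<close>\<close>
  define w :: "real^4" where "w = vector [- (1 - C * u) / u, C, - 1 / u, q$4 / u]"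
  have u: "u > 0" using q[of 2] q[of 4] by (simp add: u_def)
  have Bw: "?B *v w = ?f"
  proof -
    have e: "q$2 = 1 - u + q$4" "q$1 = 1 - u + q$4 + C * u" "q$3 = q$4 + C * u"
      using additive slope by (simp_all add: u_def)
    have "(?B *v w) $ i = ?f $ i" for i
      using exhaust_4[of i] u
      by (auto simp: matrix_vector_mult_def sum_4 replace_last_column_def transition_matrix_def
          vector_4 w_def mat_def e field_simps)
    then show ?thesis by (simp add: vec_eq_iff)
  qed
  have "det (replace_last_column ?N ?f) = det (\<chi> i j. if j = 4 then (?B *v w)$i else ?B$i$j)"
    unfolding Bw by (rule arg_cong[of _ _ det]) (simp add: replace_last_column_def vec_eq_iff)
  also have "\<dots> = q$4 / u * det ?B"
    by (subst cramer_lemma) (simp add: w_def vector_4)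
  finally show ?thesis
    using det_transition_matrix_nz[OF p q] by (simp add: payoff_def u_def)
qed

lemma equalizer_is_equilibrium:
  assumes p: "\<And>i. 0 < p$i \<and> p$i < 1"
    and additive: "p$1 + p$4 = p$2 + p$3"
    and slope: "p$1 - p$2 = C * (1 - p$2 + p$4)"
  shows "is_equilibrium (vector [1 - C, - C, 1, 0]) p"
proof -
  let ?F = "\<lambda>i t. payoff (vector [1 - C, - C, 1, 0]) (\<chi> j. if j = i then t else p$j) p"
  \<comment> \<open>The conditions on the opponent concern the second argument, which stays at
    \<open>p\<close>. Constancy on the open unit interval suffices, since \<open>p$i\<close> lies in
    it.\<close>
  have const: "?F i t = p$4 / (1 - p$2 + p$4)" if "t \<in> {0<..<1}" for i t
    using that p by (intro payoff_equalizer additive slope) auto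
  have "(?F i has_field_derivative 0) (at (p$i))" for i
    by (rule has_field_derivative_transform_within_open[OF DERIV_const, where S = "{0<..<1}"])
      (use p const in auto)
  then show ?thesis
    using p by (simp add: is_equilibrium_def adaptive_field_def DERIV_imp_deriv)
qed

lemma angle_interval_bounds:
  assumes s: "0 < s" and \<theta>: "\<theta> \<in> angle_interval s"
  shows "- 1 < sqrt s * sin \<theta>" "sqrt s * sin \<theta> < 0" "0 < sqrt s * cos \<theta>" "sqrt s * cos \<theta> < 1"
proof -
  \<comment> \<open>In terms of \<eta> the bounds become upper bounds on the sine and cosine of a
    first-quadrant angle.\<close>
  define \<eta> where "\<eta> = 2 * pi - \<theta>"
  have \<theta>_eq: "\<theta> = 2 * pi - \<eta>" by (simp add: \<eta>_def)
  have "0 < \<eta> \<and> \<eta> < pi / 2 \<and> sqrt s * sin \<eta> < 1 \<and> sqrt s * cos \<eta> < 1"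
  proof (cases "s \<le> 1")
    case True
    then have \<eta>: "0 < \<eta>" "\<eta> < pi / 2"
      using \<theta> by (auto simp: angle_interval_def \<eta>_def)
    have "sin \<eta> < 1" "cos \<eta> < 1"
      using \<eta> sin_monotone_2pi[of \<eta> "pi/2"] cos_monotone_0_pi[of 0 \<eta>] by auto
    moreover have "0 < sqrt s" "sqrt s \<le> 1" using True s by auto
    moreover have "0 < sin \<eta>" "0 < cos \<eta>" using \<eta> by (auto intro: sin_gt_zero2 cos_gt_zero)
    ultimately show ?thesis
      using \<eta> mult_le_less_imp_less[of "sqrt s" 1 "sin \<eta>" 1] mult_le_less_imp_less[of "sqrt s" 1 "cos \<eta>" 1]
      by simp
  next
    case False
    \<comment> \<open>Here the endpoints for \<eta> are the angles where
      \<open>sqrt s * cos \<eta>\<close> and \<open>sqrt s * sin \<eta>\<close>, respectively, reach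
      1.\<close>
    define c where "c = 1 / sqrt s"
    have c: "0 < c" "c \<le> 1" using False by (auto simp: c_def)
    have \<eta>: "arccos c < \<eta>" "\<eta> < arcsin c"
      using \<theta> False by (auto simp: angle_interval_def \<eta>_def c_def)
    have b: "0 < \<eta>" "\<eta> < pi / 2"
      using \<eta> arccos_lbound[of c] arcsin_ubound[of c] c by linarith+
    have "sin \<eta> < sin (arcsin c)"
      using b \<eta> arcsin_ubound[of c] c by (intro sin_monotone_2pi) auto
    moreover have "cos \<eta> < cos (arccos c)"
      using b \<eta> arccos_lbound[of c] c by (intro cos_monotone_0_pi) auto
    ultimately have "sin \<eta> < c" "cos \<eta> < c" using c by (simp_all add: cos_arccos)
    then show ?thesis using b s by (simp add: c_def field_simps)
  qed
  moreover from this have "0 < sin \<eta>" "0 < cos \<eta>" by (auto intro: sin_gt_zero2 cos_gt_zero)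
  moreover have "sin \<theta> = - sin \<eta>" "cos \<theta> = cos \<eta>"
    by (simp_all add: \<theta>_eq sin_diff cos_diff)
  ultimately show "- 1 < sqrt s * sin \<theta>" "sqrt s * sin \<theta> < 0"
      "0 < sqrt s * cos \<theta>" "sqrt s * cos \<theta> < 1"
    using s by auto
qed

text \<open>The interval is symmetric about 7 pi / 4; for \<open>s > 1\<close> this is because
  arcsin and arccos of the same number add up to pi / 2.\<close>

lemma angle_interval_reflect:
  assumes "0 < s" "\<theta> \<in> angle_interval s"
  shows "7 * pi / 2 - \<theta> \<in> angle_interval s"
proof (cases "s \<le> 1")
  case True
  then show ?thesis using assms by (auto simp: angle_interval_def)
next
  case False
  then have "0 \<le> 1 / sqrt s" "1 / sqrt s \<le> 1" using assms by auto
  then have "arccos (1 / sqrt s) = pi / 2 - arcsin (1 / sqrt s)"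
    by (intro arccos_arcsin_eq) linarith+
  then show ?thesis using assms False by (auto simp: angle_interval_def)
qed

lemma sin_cos_seven_half_pi_minus:
  fixes \<theta> :: real
  shows "sin (7 * pi / 2 - \<theta>) = - cos \<theta>" "cos (7 * pi / 2 - \<theta>) = - sin \<theta>"
proof -
  have eq: "7 * pi / 2 - \<theta> = (pi / 2 - \<theta>) + pi + 2 * pi" by simp
  show "sin (7 * pi / 2 - \<theta>) = - cos \<theta>" "cos (7 * pi / 2 - \<theta>) = - sin \<theta>"
    unfolding eq by (simp_all only: sin_periodic cos_periodic sin_periodic_pi cos_periodic_pi)
      (simp_all add: sin_diff cos_diff)
qed

lemma torus_point_equilibrium:
  assumes C12: "0 < C1" "0 < C2"
    and \<phi>: "\<phi> \<in> angle_interval C1" and \<psi>: "\<psi> \<in> angle_interval C2"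
    and additive: "sqrt C1 * sin \<phi> - sqrt C1 * cos \<phi> = sqrt C2 * sin \<psi> - sqrt C2 * cos \<psi>"
    and slope: "sqrt C1 * sin \<phi> - sqrt C2 * sin \<psi> = C * (sqrt C2 * cos \<psi> - sqrt C2 * sin \<psi>)"
  shows "is_equilibrium (vector [1 - C, - C, 1, 0]) (torus_point C1 C2 \<phi> \<psi>)"
proof (rule equalizer_is_equilibrium)
  show "0 < torus_point C1 C2 \<phi> \<psi> $ i \<and> torus_point C1 C2 \<phi> \<psi> $ i < 1" for i
    using exhaust_4[of i] angle_interval_bounds[OF C12(1) \<phi>] angle_interval_bounds[OF C12(2) \<psi>]
    by (auto simp: torus_point_def vector_4)
qed (use additive slope in \<open>simp_all add: torus_point_def vector_4\<close>)

text \<open>The two solution families of sin x = sin y. They match the alternatives for \<phi> after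
  subtracting pi / 4, and those for \<psi> after doubling and subtracting the arccos term.\<close>

lemma sin_of_int_pi_shift:
  fixes x y :: real and k :: int
  assumes "x = y + 2 * pi * of_int k \<or> x = - y + pi * of_int (2 * k + 1)"
  shows "sin x = sin y"
  using assms
proof
  assume "x = y + 2 * pi * of_int k"
  then show ?thesis by (simp add: sin_add sin_int_2pin cos_int_2pin)
next
  assume "x = - y + pi * of_int (2 * k + 1)"
  then have "x = (pi - y) + 2 * pi * of_int k" by (simp add: algebra_simps)
  then have "sin x = sin (pi - y)" by (simp add: sin_add[of "pi - y"] sin_int_2pin cos_int_2pin)
  then show ?thesis by simp
qed

theorem lemma3p8:
  fixes C C1 C2 K :: real
  assumes "0 < C" "C < 1"
    and "0 < C1" "C1 \<le> 2"
    and "0 < C2" "C2 \<le> 2"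
    and "K = (C2 + 2 * C2 * C\<^sup>2 - C1) / (2 * C * sqrt (1 + C\<^sup>2) * C2)"
    and "\<exists>(k::int) (l::int) (\<phi>::real) (\<psi>::real).
           -1 \<le> K \<and> K \<le> 1 \<and>
           (\<psi> = 1/2 * (arcsin K + arccos (C / sqrt (1 + C\<^sup>2))) + pi * of_int k \<or>
            \<psi> = 1/2 * (- arcsin K + arccos (C / sqrt (1 + C\<^sup>2))) + of_int (2 * k + 1) / 2 * pi) \<and>
           -1 \<le> sqrt (C2 / C1) * sin (\<psi> - pi/4) \<and> sqrt (C2 / C1) * sin (\<psi> - pi/4) \<le> 1 \<and>
           (\<phi> = pi/4 + arcsin (sqrt (C2 / C1) * sin (\<psi> - pi/4)) + 2 * pi * of_int l \<or>
            \<phi> = pi/4 - arcsin (sqrt (C2 / C1) * sin (\<psi> - pi/4)) + pi * of_int (2 * l + 1)) \<and>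
           \<phi> \<in> angle_interval C1 \<and> \<psi> \<in> angle_interval C2"
  shows "\<exists>\<phi> \<in> angle_interval C1. \<exists>\<psi> \<in> angle_interval C2.
           is_equilibrium (vector [1 - C, - C, 1, 0]) (torus_point C1 C2 \<phi> \<psi>)"
proof -
  from assms(8) obtain k l :: int and \<phi> \<psi> :: real where
    K: "-1 \<le> K" "K \<le> 1" and
    \<psi>: "\<psi> = 1/2 * (arcsin K + arccos (C / sqrt (1 + C\<^sup>2))) + pi * of_int k \<or>
       \<psi> = 1/2 * (- arcsin K + arccos (C / sqrt (1 + C\<^sup>2))) + of_int (2 * k + 1) / 2 * pi" and
    S: "-1 \<le> sqrt (C2 / C1) * sin (\<psi> - pi/4)" "sqrt (C2 / C1) * sin (\<psi> - pi/4) \<le> 1" and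
    \<phi>: "\<phi> = pi/4 + arcsin (sqrt (C2 / C1) * sin (\<psi> - pi/4)) + 2 * pi * of_int l \<or>
       \<phi> = pi/4 - arcsin (sqrt (C2 / C1) * sin (\<psi> - pi/4)) + pi * of_int (2 * l + 1)" and
    I: "\<phi> \<in> angle_interval C1" "\<psi> \<in> angle_interval C2"
    by blast
  define a b c d where "a = sqrt C1 * sin \<phi>" and "b = sqrt C2 * sin \<psi>"
    and "c = sqrt C1 * cos \<phi>" and "d = sqrt C2 * cos \<psi>"
  note abcd = a_def b_def c_def d_def
  have C1_eq: "C1 = a\<^sup>2 + c\<^sup>2" and C2_eq: "C2 = b\<^sup>2 + d\<^sup>2"
    using assms by (simp_all add: abcd power_mult_distrib flip: distrib_left)

  have "sin (\<phi> - pi/4) = sin (arcsin (sqrt (C2 / C1) * sin (\<psi> - pi/4)))"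
    by (rule sin_of_int_pi_shift[where k = l]) (use \<phi> in auto)
  also have "\<dots> = sqrt (C2 / C1) * sin (\<psi> - pi/4)"
    using S by simp
  finally have "sqrt C1 * sin (\<phi> - pi/4) = sqrt C2 * sin (\<psi> - pi/4)"
    using assms by (simp add: real_sqrt_divide)
  then have "(a - c) * (sqrt 2 / 2) = (b - d) * (sqrt 2 / 2)"
    by (simp add: abcd sin_diff sin_45 cos_45 algebra_simps)
  then have additive: "a - c = b - d" by simp

  define R where "R = sqrt (1 + C\<^sup>2)"
  have R: "R > 0" "R\<^sup>2 = 1 + C\<^sup>2" by (simp_all add: R_def add_pos_nonneg)
  have CR: "0 \<le> C / R" "C / R \<le> 1"
    using assms R by (auto simp: R_def intro: real_le_rsqrt)
  \<comment> \<open>Phase shift: C sin t - cos t = R sin (t - \<alpha>).\<close>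
  define \<alpha> where "\<alpha> = arccos (C / R)"
  have cos_\<alpha>: "cos \<alpha> = C / R" using CR by (simp add: \<alpha>_def)
  have "sin \<alpha> = sqrt (1 - (C / R)\<^sup>2)" using CR by (simp add: \<alpha>_def sin_arccos)
  also have "1 - (C / R)\<^sup>2 = (1 / R)\<^sup>2" 
    using R zero_less_power[OF R(1), of 2] by (simp add: power_divide field_simps)
  finally have sin_\<alpha>: "sin \<alpha> = 1 / R" using R by simp
  have "sin (2 * \<psi> - \<alpha>) = sin (arcsin K)"
    by (rule sin_of_int_pi_shift[where k = k])
      (rule disj_forward[OF \<psi>]; simp add: \<alpha>_def R_def field_simps)
  also have "\<dots> = K" using K by simp
  finally have "(C * sin (2 * \<psi>) - cos (2 * \<psi>)) / R = K"
    by (simp add: sin_diff cos_\<alpha> sin_\<alpha> diff_divide_distrib mult.commute)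
  then have KR: "C * sin (2 * \<psi>) - cos (2 * \<psi>) = K * R"
    using R by (simp add: divide_eq_eq)
  have "(C * sin (2 * \<psi>) - cos (2 * \<psi>)) * (2 * C * C2) = C2 + 2 * C2 * C\<^sup>2 - C1"
    unfolding KR using assms(1,5) R by (simp add: assms(7) flip: R_def)
  then have "2 * C * (C * (C2 * sin (2 * \<psi>)) - C2 * cos (2 * \<psi>)) = C2 + 2 * C2 * C\<^sup>2 - C1"
    by (simp add: algebra_simps)
  moreover have "C2 * sin (2 * \<psi>) = 2 * b * d" "C2 * cos (2 * \<psi>) = d\<^sup>2 - b\<^sup>2"
    using assms(5) by (simp_all add: abcd sin_double cos_double power_mult_distrib right_diff_distrib)
  ultimately have "2 * C * (C * (2 * b * d) - (d\<^sup>2 - b\<^sup>2)) =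
      (b\<^sup>2 + d\<^sup>2) + 2 * (b\<^sup>2 + d\<^sup>2) * C\<^sup>2 - (a\<^sup>2 + c\<^sup>2)"
    by (simp flip: C1_eq C2_eq)
  moreover have c_eq: "c = a - b + d" using additive by simp
  \<comment> \<open>Since a - c = b - d, the square of a + c is 2 C1 minus the square of b - d; the
    claim is then twice the preceding equation.\<close>
  ultimately have "(b + d + 2 * C * (d - b))\<^sup>2 = (a + c)\<^sup>2"
    unfolding c_eq by (simp add: power2_eq_square algebra_simps)
  then consider "b + d + 2 * C * (d - b) = a + c" | "b + d + 2 * C * (d - b) = - (a + c)"
    by (auto simp: power2_eq_iff)
  then show ?thesis
  proof cases
    case 1
    \<comment> \<open>Inserting \<open>c_eq\<close> into the case equation leaves a - b = C (d - b),
      the slope condition.\<close>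
    have "is_equilibrium (vector [1 - C, - C, 1, 0]) (torus_point C1 C2 \<phi> \<psi>)"
      by (rule torus_point_equilibrium)
        (use assms(3,5) I additive 1 c_eq in \<open>simp_all flip: abcd add: algebra_simps\<close>)
    then show ?thesis using I by blast
  next
    case 2
    \<comment> \<open>The reflection sends (a, c) to (-c, -a), which fixes a - c and negates a +
      c.\<close>
    define \<phi>' where "\<phi>' = 7 * pi / 2 - \<phi>"
    have reflect: "sqrt C1 * sin \<phi>' = - c" "sqrt C1 * cos \<phi>' = - a"
      by (simp_all add: \<phi>'_def abcd sin_cos_seven_half_pi_minus)
    have \<phi>': "\<phi>' \<in> angle_interval C1"
      using assms(3) I by (simp add: \<phi>'_def angle_interval_reflect)
    have "is_equilibrium (vector [1 - C, - C, 1, 0]) (torus_point C1 C2 \<phi>' \<psi>)"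
      by (rule torus_point_equilibrium)
        (use assms(3,5) I \<phi>' 2 c_eq in \<open>simp_all add: reflect algebra_simps flip: b_def d_def\<close>)
    then show ?thesis using I \<phi>' by blast
  qed
qed

end
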